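(* Let $P$ be a lattice and let $\to$ be a total binary operation on $P$. Then $\to$ is an $F$-natural esp-complementation on $P$ if and only if, for all $x,y,z\in P$, (1) $(x\to y)\wedge(x\vee y)=y$; (2) $z\le x\to(z\wedge(x\vee y))$.
   Context: For a poset $P$ and $p\in P$, $[p)=\{x: x\ge p\}$, $(p]=\{x: x\le p\}$, and for $X\subseteq P$, $L(X)$ is the set of all lower bounds of $X$ in $P$. For $x,y\in P$ let $F(x,y)=L([x)\cap[y))$. A total binary operation $\to$ on $P$ is an $F$-natural esp-complementation if, for all $x,y\in P$, the set $\{u\in P: (u]\cap F(x,y)\cap[y)=\{y\}\}$ has a greatest element and $x\to y$ is equal to it. *)

theory Defs
  imports Main
begin

definition lower_bounds :: "'a::order set \<Rightarrow> 'a set"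
  where "lower_bounds X = {l. \<forall>x\<in>X. l \<le> x}"

definition is_greatest :: "'a::order \<Rightarrow> 'a set \<Rightarrow> bool"
  where "is_greatest g S \<longleftrightarrow> g \<in> S \<and> (\<forall>u\<in>S. u \<le> g)"

definition F :: "'a::order \<Rightarrow> 'a \<Rightarrow> 'a set"
  where "F x y = lower_bounds ({x..} \<inter> {y..})"

text \<open>
  The poset is the carrier type. Greatest elements are unique by antisymmetry, so
  \<open>is_greatest (imp x y) S\<close> says both that \<open>S\<close> has a greatest element and that
  \<open>imp x y\<close> is equal to it.
\<close>

definition F_natural_esp_complementation :: "('a::order \<Rightarrow> 'a \<Rightarrow> 'a) \<Rightarrow> bool"
  where "F_natural_esp_complementation imp \<longleftrightarrow>
    (\<forall>x y. is_greatest (imp x y) {u. {..u} \<inter> F x y \<inter> {y..} = {y}})"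

end

theory Submission
  imports Defs
begin

text \<open>In a lattice \<open>F x y\<close> is the principal ideal of \<open>sup x y\<close>, so
  \<open>imp x y\<close> must be the greatest \<open>u\<close> with
  \<open>inf u (sup x y) = y\<close>. Membership is (1); \<open>inf_sup_inf_sup\<close> turns
  maximality into the identity (2).\<close>

lemma F_lattice: "F (x :: 'a::lattice) y = {..sup x y}"
  unfolding F_def lower_bounds_def by (auto intro: order_trans)

text \<open>The intersection is the interval from \<open>y\<close> to
  \<open>inf u (sup x y)\<close>, which is \<open>{y}\<close> exactly when its upper end is
  \<open>y\<close>.\<close>

lemma below_inter_F_eq_singleton_iff:
  fixes u x y :: "'a::lattice"
  shows "{..u} \<inter> F x y \<inter> {y..} = {y} \<longleftrightarrow> inf u (sup x y) = y"
proof -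
  have "{..u} \<inter> F x y \<inter> {y..} = {y..inf u (sup x y)}"
    by (auto simp: F_lattice)
  then show ?thesis
    by auto
qed

lemma F_natural_esp_complementation_lattice:
  fixes imp :: "'a::lattice \<Rightarrow> 'a \<Rightarrow> 'a"
  shows "F_natural_esp_complementation imp \<longleftrightarrow>
    (\<forall>x y. inf (imp x y) (sup x y) = y \<and> (\<forall>u. inf u (sup x y) = y \<longrightarrow> u \<le> imp x y))"
  by (simp add: F_natural_esp_complementation_def is_greatest_def below_inter_F_eq_singleton_iff)

text \<open>With \<open>w = inf z (sup x y)\<close>, it makes \<open>z\<close> a candidate for
  \<open>imp x w\<close>. It holds since \<open>w \<le> sup x w \<le> sup x y\<close>.\<close>

lemma inf_sup_inf_sup:
  fixes x y z :: "'a::lattice"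
  shows "inf z (sup x (inf z (sup x y))) = inf z (sup x y)"
  by (intro order.antisym inf_greatest) (auto intro: le_infI2)

theorem theorem7p10:
  fixes imp :: "'a::lattice \<Rightarrow> 'a \<Rightarrow> 'a"
  shows "F_natural_esp_complementation imp \<longleftrightarrow>
    (\<forall>x y z. inf (imp x y) (sup x y) = y \<and> z \<le> imp x (inf z (sup x y)))"
  unfolding F_natural_esp_complementation_lattice
  \<comment> \<open>Conversely, if \<open>inf u (sup x y) = y\<close>, then (2) at
    \<open>z = u\<close> reads \<open>u \<le> imp x y\<close>.\<close>
  using inf_sup_inf_sup by metis

end
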